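(* Let $\Sigma=\{\veebar,\wedge,\vee,\mathbin{\dot\vee}\}$, let $\mathbb{A}_0,\mathbb{B}_0$ be sets of $\Phi$-teams and $k_0\in\mathbb{N}$. If $k_0<D(\mathbb{A}_0,\mathbb{B}_0)$, then D has a winning strategy in the game $\mathrm{FS}^\Sigma_{k_0}(\mathbb{A}_0,\mathbb{B}_0)$.
   Context: A domain $\Phi$ is a finite set of propositional variables; a $\Phi$-team is a set of maps $\Phi\to\{0,1\}$. A split of $T$ is $(T_1,T_2)$ with $T_1,T_2\subseteq T$, $T_1\cup T_2=T$; strict if $T_1\cap T_2=\emptyset$; $\mathrm{Sp}(T)$, $\mathrm{SSp}(T)$ are the sets of splits and strict splits. $\Phi$-literals: $\top,\bot,{\sim}\top,{\sim}\bot,p,\neg p,{\sim}p,{\sim}\neg p$ ($p\in\Phi$), with $T\models\top$ always, $T\models\bot$ iff $T=\emptyset$, $T\models p$ iff $s(p)=1$ for all $s\in T$, $T\models\neg p$ iff $s(p)=0$ for all $s\in T$, $T\models{\sim}\ell$ iff $T\not\models\ell$. A literal $\ell$ separates $\mathbb{A}$ from $\mathbb{B}$ if $A\models\ell$ for all $A\in\mathbb{A}$ and $B\not\models\ell$ for all $B\in\mathbb{B}$. A team $T'$ is a neighbour of $T$ if $T'=T\setminus\{s\}$ for some $s\in T$; $N(T,\mathbb{A})$ is the number of neighbours of $T$ in $\mathbb{A}$; the density is $D(\mathbb{A},\mathbb{B})=\max\{N(A,\mathbb{B}):A\in\mathbb{A}\}$. The game $\mathrm{FS}^\Sigma_{k_0}(\mathbb{A}_0,\mathbb{B}_0)$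 between S and D has positions $(k,\mathbb{A},\mathbb{B})$, starting at $(k_0,\mathbb{A}_0,\mathbb{B}_0)$. If $k_0=0$, D wins. In a position with $k\geq 1$, S makes one of the following moves; in each connective move S also chooses $k_1,k_2>0$ with $k_1+k_2=k$, then D chooses $i\in\{1,2\}$ and play continues from the indicated position. $\veebar$-move: S chooses $\mathbb{A}_1,\mathbb{A}_2\subseteq\mathbb{A}$ with union $\mathbb{A}$; next $(k_i,\mathbb{A}_i,\mathbb{B})$. $\wedge$-move: S chooses $\mathbb{B}_1,\mathbb{B}_2\subseteq\mathbb{B}$ with union $\mathbb{B}$; next $(k_i,\mathbb{A},\mathbb{B}_i)$. $\vee$-move: for each $A\in\mathbb{A}$ S chooses $(A_1,A_2)\in\mathrm{Sp}(A)$, for each $B\in\mathbb{B}$ a function $f_B:\mathrm{Sp}(B)\to\{1,2\}$; $\mathbb{A}_i=\{A_i:A\in\mathbb{A}\}$, $\mathbb{B}_i=\{B_i:B\in\mathbb{B},(B_1,B_2)\in\mathrm{Sp}(B),f_B(B_1,B_2)=i\}$; next $(k_i,\mathbb{A}_i,\mathbb{B}_i)$. $\mathbin{\dot\vee}$-move: as the $\vee$-move with $\mathrm{SSp}$ in place of $\mathrm{Sp}$. Literal move: S chooses a $\Phi$-literal $\ell$; S wins if $\ell$ separates $\mathbb{A}$ from $\mathbb{B}$, otherwise D wins. *)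

theory Defs
  imports Main "HOL-Library.FuncSet"
begin

type_synonym 'p team = "('p \<Rightarrow> bool) set"

text \<open>Maps from \<open>\<Phi>\<close> to \<open>{0, 1}\<close> are extensional functions into \<open>bool\<close>, with \<open>True\<close> as 1.\<close>
definition teams :: "'p set \<Rightarrow> 'p team set" where
  "teams \<Phi> = Pow (\<Phi> \<rightarrow>\<^sub>E UNIV)"

definition splits :: "'p team \<Rightarrow> ('p team \<times> 'p team) set" where
  "splits T = {(T1, T2). T1 \<subseteq> T \<and> T2 \<subseteq> T \<and> T1 \<union> T2 = T}"

definition strict_splits :: "'p team \<Rightarrow> ('p team \<times> 'p team) set" where
  "strict_splits T = {(T1, T2). (T1, T2) \<in> splits T \<and> T1 \<inter> T2 = {}}"

datatype 'p atom = Top | Bot | Var 'p | NegVar 'p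

text \<open>\<open>SNeg\<close> is the strong (contradictory) negation \<open>\<sim>\<close>.\<close>
datatype 'p literal = Plain "'p atom" | SNeg "'p atom"

definition literals :: "'p set \<Rightarrow> 'p literal set" where
  "literals \<Phi> =
     {Plain Top, Plain Bot, SNeg Top, SNeg Bot} \<union>
     Plain ` Var ` \<Phi> \<union> Plain ` NegVar ` \<Phi> \<union> SNeg ` Var ` \<Phi> \<union> SNeg ` NegVar ` \<Phi>"

fun sat_atom :: "'p team \<Rightarrow> 'p atom \<Rightarrow> bool" where
  "sat_atom T Top \<longleftrightarrow> True"
| "sat_atom T Bot \<longleftrightarrow> T = {}"
| "sat_atom T (Var p) \<longleftrightarrow> (\<forall>s\<in>T. s p)"
| "sat_atom T (NegVar p) \<longleftrightarrow> (\<forall>s\<in>T. \<not> s p)"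

fun sat :: "'p team \<Rightarrow> 'p literal \<Rightarrow> bool" where
  "sat T (Plain a) \<longleftrightarrow> sat_atom T a"
| "sat T (SNeg a) \<longleftrightarrow> \<not> sat_atom T a"

definition separates :: "'p literal \<Rightarrow> 'p team set \<Rightarrow> 'p team set \<Rightarrow> bool" where
  "separates l \<A> \<B> \<longleftrightarrow> (\<forall>A\<in>\<A>. sat A l) \<and> (\<forall>B\<in>\<B>. \<not> sat B l)"

definition neighbour :: "'p team \<Rightarrow> 'p team \<Rightarrow> bool" where
  "neighbour T' T \<longleftrightarrow> (\<exists>s\<in>T. T' = T - {s})"

definition num_neighbours :: "'p team \<Rightarrow> 'p team set \<Rightarrow> nat" where
  "num_neighbours T \<A> = card {T'\<in>\<A>. neighbour T' T}"

text \<open>The maximum over an empty family is taken to be 0.\<close>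
definition density :: "'p team set \<Rightarrow> 'p team set \<Rightarrow> nat" where
  "density \<A> \<B> = (if \<A> = {} then 0 else Max {num_neighbours A \<B> |A. A \<in> \<A>})"

text \<open>In this order: the global disjunction (underlined vee), wedge, vee, and vee with a dot.\<close>
datatype connective = GlobalOr | And | SplitOr | StrictSplitOr

datatype player = Spoiler | Duplicator

datatype side = One | Two

fun component :: "side \<Rightarrow> 'a \<times> 'a \<Rightarrow> 'a" where
  "component One (x, y) = x"
| "component Two (x, y) = y"

type_synonym 'p position = "nat \<times> 'p team set \<times> 'p team set"

text \<open>
  Connective moves of \<open>Spoiler\<close>; the first component is \<open>(k1, k2)\<close>. In the two splitting moves,
  \<open>g A\<close> is the split chosen for \<open>A\<close> and \<open>f B\<close> is the function chosen for \<open>B\<close>; their values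
  outside \<open>\<A>\<close>, \<open>\<B>\<close> and the splits of \<open>B\<close> play no role.
\<close>
datatype 'p cmove =
    GlobalOrMove "nat \<times> nat" "'p team set \<times> 'p team set"
  | AndMove "nat \<times> nat" "'p team set \<times> 'p team set"
  | SplitMove "nat \<times> nat" "'p team \<Rightarrow> 'p team \<times> 'p team" "'p team \<Rightarrow> 'p team \<times> 'p team \<Rightarrow> side"
  | StrictSplitMove "nat \<times> nat" "'p team \<Rightarrow> 'p team \<times> 'p team" "'p team \<Rightarrow> 'p team \<times> 'p team \<Rightarrow> side"

definition resource_split :: "nat \<Rightarrow> nat \<times> nat \<Rightarrow> bool" where
  "resource_split k ks \<longleftrightarrow> fst ks > 0 \<and> snd ks > 0 \<and> fst ks + snd ks = k"

definition cover :: "'a set \<Rightarrow> 'a set \<times> 'a set \<Rightarrow> bool" where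
  "cover X Xs \<longleftrightarrow> fst Xs \<subseteq> X \<and> snd Xs \<subseteq> X \<and> fst Xs \<union> snd Xs = X"

fun legal :: "connective set \<Rightarrow> 'p position \<Rightarrow> 'p cmove \<Rightarrow> bool" where
  "legal \<Sigma> (k, \<A>, \<B>) (GlobalOrMove ks \<A>s) \<longleftrightarrow>
     GlobalOr \<in> \<Sigma> \<and> resource_split k ks \<and> cover \<A> \<A>s"
| "legal \<Sigma> (k, \<A>, \<B>) (AndMove ks \<B>s) \<longleftrightarrow>
     And \<in> \<Sigma> \<and> resource_split k ks \<and> cover \<B> \<B>s"
| "legal \<Sigma> (k, \<A>, \<B>) (SplitMove ks g f) \<longleftrightarrow>
     SplitOr \<in> \<Sigma> \<and> resource_split k ks \<and> (\<forall>A\<in>\<A>. g A \<in> splits A)"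
| "legal \<Sigma> (k, \<A>, \<B>) (StrictSplitMove ks g f) \<longleftrightarrow>
     StrictSplitOr \<in> \<Sigma> \<and> resource_split k ks \<and> (\<forall>A\<in>\<A>. g A \<in> strict_splits A)"

fun next_pos :: "'p position \<Rightarrow> 'p cmove \<Rightarrow> side \<Rightarrow> 'p position" where
  "next_pos (k, \<A>, \<B>) (GlobalOrMove ks \<A>s) i = (component i ks, component i \<A>s, \<B>)"
| "next_pos (k, \<A>, \<B>) (AndMove ks \<B>s) i = (component i ks, \<A>, component i \<B>s)"
| "next_pos (k, \<A>, \<B>) (SplitMove ks g f) i =
     (component i ks,
      {component i (g A) |A. A \<in> \<A>},
      {component i sp |B sp. B \<in> \<B> \<and> sp \<in> splits B \<and> f B sp = i})"
| "next_pos (k, \<A>, \<B>) (StrictSplitMove ks g f) i =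
     (component i ks,
      {component i (g A) |A. A \<in> \<A>},
      {component i sp |B sp. B \<in> \<B> \<and> sp \<in> strict_splits B \<and> f B sp = i})"

text \<open>
  A strategy of \<open>Duplicator\<close> answers the last move of a history, which lists the positions visited
  so far together with the connective moves made by \<open>Spoiler\<close> in them.
\<close>
type_synonym 'p strategy = "('p position \<times> 'p cmove) list \<Rightarrow> side"

text \<open>
  \<open>play \<Phi> \<Sigma> \<sigma> h P w\<close>: some play that continues from position \<open>P\<close> after the history \<open>h\<close>, with
  \<open>Duplicator\<close> following \<open>\<sigma>\<close>, is won by \<open>w\<close>. Connective moves strictly decrease the resource, so
  every play is finite, and resource 0 occurs in an initial position only.
\<close>
inductive play :: "'p set \<Rightarrow> connective set \<Rightarrow> 'p strategy \<Rightarrow>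
    ('p position \<times> 'p cmove) list \<Rightarrow> 'p position \<Rightarrow> player \<Rightarrow> bool"
  for \<Phi> :: "'p set" and \<Sigma> :: "connective set" and \<sigma> :: "'p strategy" where
  zero: "play \<Phi> \<Sigma> \<sigma> h (0, \<A>, \<B>) Duplicator"
| literal: "k \<ge> 1 \<Longrightarrow> l \<in> literals \<Phi> \<Longrightarrow>
    play \<Phi> \<Sigma> \<sigma> h (k, \<A>, \<B>) (if separates l \<A> \<B> then Spoiler else Duplicator)"
| connective: "k \<ge> 1 \<Longrightarrow> legal \<Sigma> (k, \<A>, \<B>) m \<Longrightarrow> h' = h @ [((k, \<A>, \<B>), m)] \<Longrightarrow>
    play \<Phi> \<Sigma> \<sigma> h' (next_pos (k, \<A>, \<B>) m (\<sigma> h')) w \<Longrightarrow>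
    play \<Phi> \<Sigma> \<sigma> h (k, \<A>, \<B>) w"

definition D_has_winning_strategy ::
    "'p set \<Rightarrow> connective set \<Rightarrow> nat \<Rightarrow> 'p team set \<Rightarrow> 'p team set \<Rightarrow> bool" where
  "D_has_winning_strategy \<Phi> \<Sigma> k \<A> \<B> \<longleftrightarrow>
     (\<exists>\<sigma>. \<forall>w. play \<Phi> \<Sigma> \<sigma> [] (k, \<A>, \<B>) w \<longrightarrow> w = Duplicator)"

end

theory Submission
  imports Defs
begin

text \<open>
  Duplicator keeps the following invariant: either the two families share a team, or some team of
  \<open>\<A>\<close> has more than \<open>k\<close> neighbours in \<open>\<B>\<close>. A splitting move splits a dense team \<open>A\<close> into
  \<open>(A1, A2)\<close>, and each neighbour \<open>A - {s}\<close> has the split \<open>(A1 - {s}, A2 - {s})\<close>. On the side \<open>i\<close>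
  selected by Spoiler for that split, \<open>Ai - {s}\<close> is either a neighbour of \<open>Ai\<close> or \<open>Ai\<close> itself. In
  the latter case the two families share a team, and otherwise the neighbours are distributed over
  the two sides, so one side gets more of them than its share of the resource. The invariant
  excludes a separating literal: two distinct neighbours of a team cannot both disagree with it on
  a literal.
\<close>

definition removable :: "'p team \<Rightarrow> 'p team set \<Rightarrow> ('p \<Rightarrow> bool) set" where
  "removable A \<B> = {s \<in> A. A - {s} \<in> \<B>}"

text \<open>The finite subset \<open>S\<close> avoids any finiteness assumption on the teams.\<close>
definition dense_over :: "nat \<Rightarrow> 'p team \<Rightarrow> 'p team set \<Rightarrow> bool" where
  "dense_over k A \<B> \<longleftrightarrow> (\<exists>S \<subseteq> removable A \<B>. finite S \<and> k < card S)"

fun invariant :: "'p position \<Rightarrow> bool" where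
  "invariant (k, \<A>, \<B>) \<longleftrightarrow> \<A> \<inter> \<B> \<noteq> {} \<or> (\<exists>A\<in>\<A>. dense_over k A \<B>)"

lemma dense_overI: "S \<subseteq> removable A \<B> \<Longrightarrow> finite S \<Longrightarrow> k < card S \<Longrightarrow> dense_over k A \<B>"
  unfolding dense_over_def by (intro exI conjI)

lemma dense_over_antimono: "dense_over k A \<B> \<Longrightarrow> k' \<le> k \<Longrightarrow> dense_over k' A \<B>"
  unfolding dense_over_def using le_less_trans by blast

text \<open>Pigeonhole: the traces of \<open>S\<close> on the two covering sets together exhaust
  \<open>S\<close>, so their sizes cannot be at most \<open>k1\<close> and \<open>k2\<close>
  respectively. Conjunction moves use this with \<open>A1 = A2 = A\<close>, splitting moves with the
  two halves of \<open>A\<close>.\<close>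

lemma dense_over_cover_cases:
  assumes "dense_over (k1 + k2) A \<B>"
    and cov: "removable A \<B> \<subseteq> removable A1 \<B>1 \<union> removable A2 \<B>2"
  shows "dense_over k1 A1 \<B>1 \<or> dense_over k2 A2 \<B>2"
proof -
  obtain S where S: "S \<subseteq> removable A \<B>" "finite S" "k1 + k2 < card S"
    using assms(1) unfolding dense_over_def by blast
  let ?S1 = "S \<inter> removable A1 \<B>1" and ?S2 = "S \<inter> removable A2 \<B>2"
  have "?S1 \<union> ?S2 = S" using S(1) cov by blast
  then have "card S \<le> card ?S1 + card ?S2" using card_Un_le[of ?S1 ?S2] by simp
  then have "k1 < card ?S1 \<or> k2 < card ?S2" using S(3) by linarith
  then show ?thesis
    using dense_overI[of ?S1 A1 \<B>1 k1] dense_overI[of ?S2 A2 \<B>2 k2] S(2) by auto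
qed

lemma sat_atom_subset: "sat_atom A a \<Longrightarrow> B \<subseteq> A \<Longrightarrow> sat_atom B a"
  by (cases a) auto

lemma sat_atom_Un: "sat_atom (A \<union> B) a \<longleftrightarrow> sat_atom A a \<and> sat_atom B a"
  by (cases a) (simp_all add: ball_Un)

text \<open>Atoms are preserved under unions of teams, and two distinct neighbours of
  \<open>A\<close> have union \<open>A\<close>.\<close>

lemma sat_atom_of_two_neighbours:
  assumes "s \<noteq> t" "sat_atom (A - {s}) a" "sat_atom (A - {t}) a"
  shows "sat_atom A a"
proof -
  have "(A - {s}) \<union> (A - {t}) = A" using assms(1) by blast
  then show ?thesis using assms(2,3) sat_atom_Un[of "A - {s}" "A - {t}" a] by simp
qed

lemma invariant_not_separates:
  assumes "invariant (k, \<A>, \<B>)" "k \<ge> 1"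
  shows "\<not> separates l \<A> \<B>"
proof
  assume sep: "separates l \<A> \<B>"
  then have "\<A> \<inter> \<B> = {}" unfolding separates_def by blast
  then obtain A S where A: "A \<in> \<A>" and S: "S \<subseteq> removable A \<B>" "finite S" "k < card S"
    using assms(1) unfolding invariant.simps dense_over_def by blast
  \<comment> \<open>More than \<open>k \<ge> 1\<close> removable assignments means at least two. The
    \<open>Plain\<close> case below refutes separation with one neighbour, by downward closure; the
    \<open>SNeg\<close> case takes both.\<close>
  have "\<not> card S \<le> Suc 0" using S(3) assms(2) by linarith
  then obtain s t where st: "s \<in> S" "t \<in> S" "s \<noteq> t"
    using card_le_Suc0_iff_eq[OF S(2)] by blast
  then have mem: "A - {s} \<in> \<B>" "A - {t} \<in> \<B>"
    using S(1) unfolding removable_def by auto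
  have sat: "sat A l" "\<not> sat (A - {s}) l" "\<not> sat (A - {t}) l"
    using sep A mem unfolding separates_def by auto
  show False
  proof (cases l)
    case (Plain a)
    then show False using sat sat_atom_subset[of A a "A - {s}"] by simp
  next
    case (SNeg a)
    then show False using sat sat_atom_of_two_neighbours[OF st(3), of A a] by simp
  qed
qed

text \<open>\<open>Sp\<close> stands for \<open>splits\<close> or \<open>strict_splits\<close>. Both
  are closed under deleting one assignment from a team and its two parts, so a split of a dense team
  induces splits of its neighbours.\<close>

lemma invariant_split:
  fixes Sp :: "'p team \<Rightarrow> ('p team \<times> 'p team) set"
    and g :: "'p team \<Rightarrow> 'p team \<times> 'p team"
  assumes inv: "invariant (k, \<A>, \<B>)" and ks: "resource_split k ks"
    and g: "\<And>A. A \<in> \<A> \<Longrightarrow> g A \<in> Sp A"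
    and Sp_remove: "\<And>T T1 T2 s. (T1, T2) \<in> Sp T \<Longrightarrow> (T1 - {s}, T2 - {s}) \<in> Sp (T - {s})"
  shows "\<exists>i. invariant (component i ks, {component i (g A) |A. A \<in> \<A>},
    {component i sp |B sp. B \<in> \<B> \<and> sp \<in> Sp B \<and> f B sp = i})"
    (is "\<exists>i. invariant (_, ?A i, ?B i)")
proof -
  have B: "component (f B sp) sp \<in> ?B (f B sp)" if "B \<in> \<B>" "sp \<in> Sp B" for B sp
    using that by blast
  show ?thesis
  proof (cases "\<exists>i. ?A i \<inter> ?B i \<noteq> {}")
    case True
    then obtain i where "?A i \<inter> ?B i \<noteq> {}" by (rule exE)
    then have "invariant (component i ks, ?A i, ?B i)" unfolding invariant.simps by (rule disjI1)
    then show ?thesis by (rule exI)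
  next
    case False
    \<comment> \<open>For a shared team \<open>T\<close>, the split \<open>g T\<close> is also among
      the splits of \<open>T\<close> on the right. The component that \<open>f\<close> selects from
      it would then be shared on side \<open>?i\<close>.\<close>
    have "\<A> \<inter> \<B> = {}"
    proof (rule ccontr)
      assume "\<A> \<inter> \<B> \<noteq> {}"
      then obtain T where T: "T \<in> \<A>" "T \<in> \<B>" by blast
      let ?i = "f T (g T)"
      have "component ?i (g T) \<in> ?A ?i" using T(1) by blast
      then show False using False B[OF T(2) g[OF T(1)]] by blast
    qed
    then obtain A where A: "A \<in> \<A>" and dense: "dense_over k A \<B>"
      using inv by auto
    obtain A1 A2 where gA: "g A = (A1, A2)" by fastforce
    obtain k1 k2 where k: "ks = (k1, k2)" "k = k1 + k2"
      using ks unfolding resource_split_def by (metis prod.collapse)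
    have "component i (g A) \<in> ?A i" for i using A by blast
    from this[of One] this[of Two] have mem: "A1 \<in> ?A One" "A2 \<in> ?A Two"
      unfolding gA component.simps by simp_all
    have "removable A \<B> \<subseteq> removable A1 (?B One) \<union> removable A2 (?B Two)"
    proof
      fix s assume "s \<in> removable A \<B>"
      then have s: "A - {s} \<in> \<B>" unfolding removable_def by auto
      let ?sp = "(A1 - {s}, A2 - {s})"
      have sp: "?sp \<in> Sp (A - {s})" using g[OF A] gA Sp_remove by simp
      show "s \<in> removable A1 (?B One) \<union> removable A2 (?B Two)"
      proof (cases "f (A - {s}) ?sp")
        case One
        then have A1: "A1 - {s} \<in> ?B One" using B[OF s sp] by simp
        \<comment> \<open>Otherwise \<open>A1 - {s}\<close> is \<open>A1\<close> itself, a team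
          shared by both families on this side.\<close>
        have "s \<in> A1"
        proof (rule ccontr)
          assume "s \<notin> A1"
          then have "A1 \<in> ?B One" using A1 by simp
          then show False using False mem(1) by blast
        qed
        then show ?thesis using A1 unfolding removable_def by blast
      next
        case Two
        then have A2: "A2 - {s} \<in> ?B Two" using B[OF s sp] by simp
        have "s \<in> A2"
        proof (rule ccontr)
          assume "s \<notin> A2"
          then have "A2 \<in> ?B Two" using A2 by simp
          then show False using False mem(2) by blast
        qed
        then show ?thesis using A2 unfolding removable_def by blast
      qed
    qed
    then have "dense_over k1 A1 (?B One) \<or> dense_over k2 A2 (?B Two)"
      using dense_over_cover_cases dense k(2) by blast
    then show ?thesis
    proof
      assume "dense_over k1 A1 (?B One)"
      then have "invariant (component One ks, ?A One, ?B One)"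
        unfolding invariant.simps k(1) component.simps(1)[of k1 k2]
        using mem(1) by (intro disjI2) (rule bexI)
      then show ?thesis by (rule exI)
    next
      assume "dense_over k2 A2 (?B Two)"
      then have "invariant (component Two ks, ?A Two, ?B Two)"
        unfolding invariant.simps k(1) component.simps(2)[of k1 k2]
        using mem(2) by (intro disjI2) (rule bexI)
      then show ?thesis by (rule exI)
    qed
  qed
qed

lemma invariant_next_pos:
  assumes inv: "invariant (k, \<A>, \<B>)" and "legal \<Sigma> (k, \<A>, \<B>) m"
  shows "\<exists>i. invariant (next_pos (k, \<A>, \<B>) m i)"
proof (cases m)
  case (GlobalOrMove ks \<A>s)
  obtain k1 k2 \<A>1 \<A>2 where eq: "ks = (k1, k2)" "\<A>s = (\<A>1, \<A>2)" by fastforce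
  have k: "k = k1 + k2" and \<A>: "\<A> = \<A>1 \<union> \<A>2"
    using assms(2) GlobalOrMove eq by (auto simp: resource_split_def cover_def)
  \<comment> \<open>The right family stays fixed and each share is at most \<open>k\<close>, so a
    dense team remains dense in whichever part contains it.\<close>
  have "dense_over k A \<B> \<Longrightarrow> dense_over k1 A \<B> \<and> dense_over k2 A \<B>" for A
    using dense_over_antimono[of k A \<B> k1] dense_over_antimono[of k A \<B> k2] k by simp
  then have "invariant (k1, \<A>1, \<B>) \<or> invariant (k2, \<A>2, \<B>)"
    using inv unfolding invariant.simps \<A> by blast
  then show ?thesis
    unfolding GlobalOrMove eq next_pos.simps by (metis component.simps)
next
  case (AndMove ks \<B>s)
  obtain k1 k2 \<B>1 \<B>2 where eq: "ks = (k1, k2)" "\<B>s = (\<B>1, \<B>2)" by fastforce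
  have k: "k = k1 + k2" and \<B>: "\<B> = \<B>1 \<union> \<B>2"
    using assms(2) AndMove eq by (auto simp: resource_split_def cover_def)
  have "removable A \<B> \<subseteq> removable A \<B>1 \<union> removable A \<B>2" for A
    unfolding removable_def \<B> by blast
  then have "dense_over k A \<B> \<Longrightarrow> dense_over k1 A \<B>1 \<or> dense_over k2 A \<B>2" for A
    using dense_over_cover_cases k by blast
  then have "invariant (k1, \<A>, \<B>1) \<or> invariant (k2, \<A>, \<B>2)"
    using inv unfolding invariant.simps \<B> by blast
  then show ?thesis
    unfolding AndMove eq next_pos.simps by (metis component.simps)
next
  case (SplitMove ks g f)
  show ?thesis
    unfolding SplitMove next_pos.simps
    using assms SplitMove by (intro invariant_split[OF inv]) (auto simp: splits_def)
next
  case (StrictSplitMove ks g f)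
  show ?thesis
    unfolding StrictSplitMove next_pos.simps
    using assms StrictSplitMove
    by (intro invariant_split[OF inv]) (auto simp: strict_splits_def splits_def)
qed

text \<open>In a play, the last entry of the history holds the current position and the move to be
  answered. \<open>invariant_next_pos\<close> makes the choice meaningful when that move is legal
  and the position satisfies the invariant.\<close>

definition invariant_strategy :: "'p strategy" where
  "invariant_strategy h = (SOME i. invariant (next_pos (fst (last h)) (snd (last h)) i))"

lemma play_invariant_strategy:
  assumes "play \<Phi> \<Sigma> invariant_strategy h P w" "invariant P"
  shows "w = Duplicator"
  using assms
proof (induction rule: play.induct)
  case (literal k l h \<A> \<B>)
  then show ?case using invariant_not_separates by metis
next
  case (connective k \<A> \<B> m h' h w)
  have "invariant (next_pos (k, \<A>, \<B>) m (invariant_strategy h'))"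
    using someI_ex[OF invariant_next_pos[OF connective.prems connective.hyps(2)]]
    unfolding invariant_strategy_def connective.hyps(3) by simp
  then show ?case by (rule connective.IH)
qed simp

lemma invariant_of_density:
  assumes "finite \<Phi>" "\<A> \<subseteq> teams \<Phi>" "k < density \<A> \<B>"
  shows "invariant (k, \<A>, \<B>)"
proof -
  have fin: "finite (\<Phi> \<rightarrow>\<^sub>E (UNIV :: bool set))"
    using assms(1) by (simp add: finite_PiE)
  then have "finite \<A>"
    using assms(2) unfolding teams_def by (meson finite_Pow_iff finite_subset)
  then have finN: "finite {num_neighbours A \<B> |A. A \<in> \<A>}" by simp
  \<comment> \<open>The density of an empty family is 0, which no \<open>k\<close> is below.\<close>
  have ne: "\<A> \<noteq> {}" and "k < Max {num_neighbours A \<B> |A. A \<in> \<A>}"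
    using assms(3) unfolding density_def by (auto split: if_splits)
  then obtain A where A: "A \<in> \<A>" and k: "k < num_neighbours A \<B>"
    using Max_gr_iff[OF finN] by auto
  have "finite A"
    using A assms(2) fin unfolding teams_def by (meson PowD finite_subset subsetD)
  then have finS: "finite (removable A \<B>)" unfolding removable_def by simp
  \<comment> \<open>The neighbours are an image of the removable assignments, so there are at least
    as many of the latter; \<open>removable A \<B>\<close> itself then witnesses density.\<close>
  have "{T' \<in> \<B>. neighbour T' A} = (\<lambda>s. A - {s}) ` removable A \<B>"
    unfolding removable_def neighbour_def by auto
  then have "k < card (removable A \<B>)"
    using k card_image_le[OF finS] unfolding num_neighbours_def by (metis less_le_trans)
  then have "dense_over k A \<B>" using dense_overI finS by blast
  then show ?thesis using A by auto
qed

theorem theorem3p8: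
  fixes \<Phi> :: "'p set" and \<A>\<^sub>0 \<B>\<^sub>0 :: "'p team set" and k\<^sub>0 :: nat
  assumes "finite \<Phi>"
    and "\<A>\<^sub>0 \<subseteq> teams \<Phi>" and "\<B>\<^sub>0 \<subseteq> teams \<Phi>"
    and "k\<^sub>0 < density \<A>\<^sub>0 \<B>\<^sub>0"
  shows "D_has_winning_strategy \<Phi> {GlobalOr, And, SplitOr, StrictSplitOr} k\<^sub>0 \<A>\<^sub>0 \<B>\<^sub>0"
  unfolding D_has_winning_strategy_def
  using play_invariant_strategy invariant_of_density[OF assms(1,2,4)] by blast

end
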